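(* Let $\alpha>0$, let $F$ be the distribution function of a positive random variable $X$ with $m(\alpha)=E(X^\alpha)<\infty$, and let $R(x)=\sum_{n=0}^{\infty}F^{\boxtimes n}(x)$ be the Kendall renewal function of $F$. Assume that $F$ has a density $f$ and that $xf(x)/\overline{F}(x)\to\beta$ as $x\to\infty$, where $\beta>\alpha$. Then for every $y>0$, $$\lim_{x\to\infty}x^{\alpha+1}\bigl(\overline{F}(x+y)-\overline{F}(x)\bigr)=0,$$ and consequently $$\lim_{x\to\infty}\frac{1}{x^{\alpha-1}}\bigl(R(x+y)-R(x)\bigr)=\frac{2\alpha}{m(\alpha)}\,y.$$
   Context: Fix $\alpha>0$. $X$ is a positive random variable with distribution function $F(x)=P(X\le x)$, $F(0-)=0$, $F$ continuous; $\overline{F}=1-F$; $m(\alpha)=\int_0^\infty y^\alpha\,dF(y)$. The Williamson transform ($G$-transform) of a distribution function $F$ with $F(0-)=0$ is $G_F(x)=\int_0^x\bigl(1-(t/x)^\alpha\bigr)\,dF(t)$, $x>0$. The Kendall convolution $F_1\boxtimes F_2$ of two distribution functions with $F_i(0-)=0$ is the distribution function $F_3$ (with $F_3(0-)=0$) determined by $G_{F_3}(x)=G_{F_1}(x)G_{F_2}(x)$. The $n$-fold Kendall convolution $F^{\boxtimes n}$ is thus the distribution function with $G$-transform $G_F^n$, and $F^{\boxtimes 0}$ is the distribution function of the point mass at $0$. *)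

theory Defs
  imports "HOL-Probability.Probability"
begin

definition nonneg_df :: "(real \<Rightarrow> real) \<Rightarrow> bool" where
  "nonneg_df F \<longleftrightarrow>
     mono F \<and> (\<forall>x. continuous (at_right x) F) \<and> (\<forall>x<0. F x = 0) \<and> (F \<longlongrightarrow> 1) at_top"

(* The closed interval is essential: an atom of F at 0 contributes with weight 1,
   so the point mass at 0 has transform 1. *)
definition williamson :: "real \<Rightarrow> (real \<Rightarrow> real) \<Rightarrow> real \<Rightarrow> real" where
  "williamson \<alpha> F x = (LINT t:{0..x}|interval_measure F. 1 - (t / x) powr \<alpha>)"

definition kendall_conv :: "real \<Rightarrow> (real \<Rightarrow> real) \<Rightarrow> (real \<Rightarrow> real) \<Rightarrow> real \<Rightarrow> real" where
  "kendall_conv \<alpha> F1 F2 =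
     (THE F3. nonneg_df F3 \<and>
        (\<forall>x>0. williamson \<alpha> F3 x = williamson \<alpha> F1 x * williamson \<alpha> F2 x))"

primrec kendall_power :: "real \<Rightarrow> (real \<Rightarrow> real) \<Rightarrow> nat \<Rightarrow> real \<Rightarrow> real" where
  "kendall_power \<alpha> F 0 = (\<lambda>x. if x < 0 then 0 else 1)"
| "kendall_power \<alpha> F (Suc n) = kendall_conv \<alpha> (kendall_power \<alpha> F n) F"

definition kendall_renewal :: "real \<Rightarrow> (real \<Rightarrow> real) \<Rightarrow> real \<Rightarrow> real" where
  "kendall_renewal \<alpha> F x = (\<Sum>n. kendall_power \<alpha> F n x)"

end

theory Submission
  imports Defs "HOL-Real_Asymp.Real_Asymp"
begin

text \<open>
  Let \<open>G\<close> be the Williamson transform of \<open>F\<close>. The whole proof rests on an explicit formula for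
  the renewal function \<open>R\<close>. Since \<open>x powr \<alpha> * G x\<close> is a primitive of
  \<open>\<alpha> * x powr (\<alpha> - 1) * F x\<close>, the transform can be inverted by differentiation,
  \<open>F = G + x * G' / \<alpha>\<close>. The \<open>n\<close>-fold Kendall power has transform \<open>G ^ n\<close>, so its
  distribution function is \<open>n * G ^ (n - 1) * F - (n - 1) * G ^ n\<close>. As the convolution is
  defined as the unique distribution function with a prescribed transform, this requires three
  checks: the expression is a distribution function (\<open>kendall_power_form_nonneg_df\<close>, where
  monotonicity is the delicate part), it has transform \<open>G ^ n\<close>
  (\<open>williamson_kendall_power_form\<close>), and transforms are injective (\<open>williamson_inject\<close>).
  
  Summing over \<open>n\<close> gives \<open>R = 2 / (1 - G) - (1 - F) / (1 - G)\<^sup>2\<close>. With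
  \<open>H x = x powr \<alpha> * (1 - G x) = E (min (x powr \<alpha>) (X powr \<alpha>))\<close>, which tends to \<open>m\<close>,
  this reads
  \<open>R x = 2 * x powr \<alpha> / H x - (x powr \<alpha>)\<^sup>2 * (1 - F x) / (H x)\<^sup>2\<close>.
  Since the moment is finite, \<open>x powr \<alpha> * (1 - F x)\<close> tends to 0, and the condition on the density
  then makes the increment of the tail over \<open>[x, x + y]\<close> smaller in order than
  \<open>x powr (- \<alpha> - 1)\<close> (\<open>density_tail_increment_limit\<close>). Hence in the increment of \<open>R\<close>,
  divided by \<open>x powr (\<alpha> - 1)\<close>, the only part that survives is
  \<open>2 / m * ((x + y) powr \<alpha> - x powr \<alpha>) / x powr (\<alpha> - 1)\<close>, with limit
  \<open>2 * \<alpha> * y / m\<close> (\<open>kendall_renewal_increment_limit\<close>).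
\<close>

section \<open>The scaled transform and its increments\<close>

lemma interval_measure_nonneg_df:
  assumes "nonneg_df K"
  shows "real_distribution (interval_measure K)" and "cdf (interval_measure K) = K"
proof -
  have mono: "\<And>x y. x \<le> y \<Longrightarrow> K x \<le> K y" and rc: "\<And>a. continuous (at_right a) K"
    and neg: "\<And>x. x < 0 \<Longrightarrow> K x = 0" and top: "(K \<longlongrightarrow> 1) at_top"
    using assms by (auto simp: nonneg_df_def mono_def)
  have bot: "(K \<longlongrightarrow> 0) at_bot"
    by (rule tendsto_eventually) (use neg in \<open>auto simp: eventually_at_bot_linorder intro!: exI[of _ "-1"]\<close>)
  show "real_distribution (interval_measure K)"
    by (rule real_distribution_interval_measure[OF mono rc bot top])
  show "cdf (interval_measure K) = K"
    by (rule cdf_interval_measure[OF mono rc bot])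
qed

lemma nonneg_df_bounds:
  assumes "nonneg_df K"
  shows "0 \<le> K x" and "K x \<le> 1"
proof -
  interpret real_distribution "interval_measure K"
    by (rule interval_measure_nonneg_df[OF assms])
  show "0 \<le> K x" "K x \<le> 1"
    using cdf_nonneg[of x] cdf_bounded_prob[of x] interval_measure_nonneg_df(2)[OF assms] by simp_all
qed

lemma measure_Icc_nonneg_df:
  assumes "nonneg_df K" "0 \<le> x"
  shows "measure (interval_measure K) {0..x} = K x"
proof -
  interpret real_distribution "interval_measure K"
    by (rule interval_measure_nonneg_df[OF assms(1)])
  note cdf_eq = interval_measure_nonneg_df(2)[OF assms(1)]
  have "(cdf (interval_measure K) \<longlongrightarrow> 0) (at_left 0)"
    unfolding cdf_eq
    by (rule tendsto_eventually)
       (use assms(1) in \<open>auto simp: nonneg_df_def eventually_at_filter\<close>)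
  with cdf_at_left[of 0] have neg: "measure (interval_measure K) {..<0} = 0"
    using tendsto_unique trivial_limit_at_left_real by blast
  have "{..x} = {..<0} \<union> {0..x}" "{..<0} \<inter> {0..x} = {}" using assms(2) by auto
  then have "measure (interval_measure K) {..x} = measure (interval_measure K) {..<0} + measure (interval_measure K) {0..x}"
    using finite_measure_Union[of "{..<0}" "{0..x}"] by auto
  with neg show ?thesis using cdf_eq by (simp add: cdf_def fun_eq_iff)
qed

text \<open>
  Multiplying by \<open>x powr \<alpha>\<close> turns the transform into
  \<open>V x = (\<integral> max 0 (x powr \<alpha> - t powr \<alpha>) dK t) = (\<integral>s=0..x. \<alpha> * s powr (\<alpha> - 1) * K s)\<close>,
  a primitive of \<open>\<alpha> * x powr (\<alpha> - 1) * K x\<close>. This function is easier to differentiate and to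
  compare at two points than the transform itself.
\<close>
definition scaled_williamson :: "real \<Rightarrow> (real \<Rightarrow> real) \<Rightarrow> real \<Rightarrow> real" where
  "scaled_williamson \<alpha> K x = x powr \<alpha> * williamson \<alpha> K x"

lemma scaled_williamson_integral:
  assumes "x > 0"
  shows "scaled_williamson \<alpha> K x =
    (LINT t|interval_measure K. indicator {0..x} t * (x powr \<alpha> - t powr \<alpha>))"
proof -
  have "scaled_williamson \<alpha> K x =
      (LINT t|interval_measure K. x powr \<alpha> * (indicator {0..x} t * (1 - (t / x) powr \<alpha>)))"
    unfolding scaled_williamson_def williamson_def set_lebesgue_integral_def by simp
  also have "\<dots> = (LINT t|interval_measure K. indicator {0..x} t * (x powr \<alpha> - t powr \<alpha>))"
  proof (rule Bochner_Integration.integral_cong)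
    fix t
    show "x powr \<alpha> * (indicator {0..x} t * (1 - (t / x) powr \<alpha>)) =
        indicator {0..x} t * (x powr \<alpha> - t powr \<alpha>)"
      using assms by (auto simp: indicator_def powr_divide algebra_simps)
  qed simp
  finally show ?thesis .
qed

lemma truncation_integrable:
  assumes "nonneg_df K" "\<alpha> > 0" "x > 0"
  shows "integrable (interval_measure K) (\<lambda>t. indicator {0..x} t * (x powr \<alpha> - t powr \<alpha>))"
proof -
  interpret real_distribution "interval_measure K"
    by (rule interval_measure_nonneg_df[OF assms(1)])
  show ?thesis
  proof (rule integrable_const_bound[where B = "x powr \<alpha>"])
    show "AE t in interval_measure K. norm (indicator {0..x} t * (x powr \<alpha> - t powr \<alpha>)) \<le> x powr \<alpha>"
      using assms by (auto simp: indicator_def powr_mono2)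
  qed measurable
qed

lemma scaled_williamson_bounds:
  assumes K: "nonneg_df K" and "\<alpha> > 0" "x > 0"
  shows "0 \<le> scaled_williamson \<alpha> K x" and "scaled_williamson \<alpha> K x \<le> x powr \<alpha> * K x"
proof -
  interpret real_distribution "interval_measure K"
    by (rule interval_measure_nonneg_df[OF K])
  show "0 \<le> scaled_williamson \<alpha> K x"
    unfolding scaled_williamson_integral[OF \<open>x > 0\<close>]
    using assms by (intro integral_nonneg_AE) (auto simp: indicator_def powr_mono2)
  have "scaled_williamson \<alpha> K x \<le> (LINT t|interval_measure K. indicator {0..x} t * x powr \<alpha>)"
    unfolding scaled_williamson_integral[OF \<open>x > 0\<close>]
  proof (rule integral_mono)
    show "integrable (interval_measure K) (\<lambda>t. indicator {0..x} t * x powr \<alpha>)"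
      by (rule integrable_const_bound[where B = "x powr \<alpha>"]) (auto simp: indicator_def)
  qed (use assms truncation_integrable in \<open>auto simp: indicator_def\<close>)
  then show "scaled_williamson \<alpha> K x \<le> x powr \<alpha> * K x"
    using measure_Icc_nonneg_df[OF K, of x] \<open>x > 0\<close> by (simp add: mult.commute)
qed

text \<open>
  Everything about the transform is extracted from these two inequalities: they say that the
  increment of \<open>V\<close> lies between the extreme values of \<open>K\<close> on the interval times the
  increment of \<open>x powr \<alpha>\<close>, as for a Stieltjes integral of \<open>K\<close> against \<open>x powr \<alpha>\<close>.
  They hold pointwise under the integral sign.
\<close>
lemma scaled_williamson_increment:
  assumes K: "nonneg_df K" and "\<alpha> > 0" "0 < a" "a \<le> b"
  shows "K a * (b powr \<alpha> - a powr \<alpha>) \<le> scaled_williamson \<alpha> K b - scaled_williamson \<alpha> K a"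
    and "scaled_williamson \<alpha> K b - scaled_williamson \<alpha> K a \<le> K b * (b powr \<alpha> - a powr \<alpha>)"
proof -
  interpret real_distribution "interval_measure K"
    by (rule interval_measure_nonneg_df[OF K])
  have "0 < b" using assms by simp
  define g where "g = (\<lambda>x t::real. indicator {0..x} t * (x powr \<alpha> - t powr \<alpha>))"
  have int_g: "integrable (interval_measure K) (g x)" if "x > 0" for x
    using truncation_integrable[OF K \<open>\<alpha> > 0\<close> that] by (simp add: g_def)
  have diff: "scaled_williamson \<alpha> K b - scaled_williamson \<alpha> K a = (LINT t|interval_measure K. g b t - g a t)"
    using scaled_williamson_integral[of a \<alpha> K] scaled_williamson_integral[of b \<alpha> K]
      int_g[OF \<open>0 < a\<close>] int_g[OF \<open>0 < b\<close>] \<open>0 < a\<close> \<open>0 < b\<close> by (simp add: g_def)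
  define d where "d = b powr \<alpha> - a powr \<alpha>"
  have int_ind: "integrable (interval_measure K) (\<lambda>t. indicator {0..x} t * d)" for x
    by (rule integrable_const_bound[where B = "\<bar>d\<bar>"]) (auto simp: indicator_def)
  have ind: "(LINT t|interval_measure K. indicator {0..x} t * d) = K x * d" if "0 \<le> x" for x
    by (simp add: measure_Icc_nonneg_df[OF K that])
  have p: "s powr \<alpha> \<le> t powr \<alpha>" if "0 \<le> s" "s \<le> t" for s t
    using that \<open>\<alpha> > 0\<close> by (simp add: powr_mono2)
  have int_diff: "integrable (interval_measure K) (\<lambda>t. g b t - g a t)"
    using int_g[OF \<open>0 < a\<close>] int_g[OF \<open>0 < b\<close>] by simp
  have "(LINT t|interval_measure K. indicator {0..a} t * d) \<le> (LINT t|interval_measure K. g b t - g a t)"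
    using p \<open>0 < a\<close> \<open>a \<le> b\<close> int_ind int_diff
    by (intro integral_mono) (auto simp: g_def d_def indicator_def)
  then show "K a * (b powr \<alpha> - a powr \<alpha>) \<le> scaled_williamson \<alpha> K b - scaled_williamson \<alpha> K a"
    unfolding ind[OF less_imp_le[OF \<open>0 < a\<close>]] by (simp add: diff d_def)
  have "(LINT t|interval_measure K. g b t - g a t) \<le> (LINT t|interval_measure K. indicator {0..b} t * d)"
    using p \<open>0 < a\<close> \<open>a \<le> b\<close> int_ind int_diff
    by (intro integral_mono) (auto simp: g_def d_def indicator_def)
  then show "scaled_williamson \<alpha> K b - scaled_williamson \<alpha> K a \<le> K b * (b powr \<alpha> - a powr \<alpha>)"
    unfolding ind[OF less_imp_le[OF \<open>0 < b\<close>]] by (simp add: diff d_def)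
qed

text \<open>
  A right-continuous \<open>J\<close> with \<open>J x < L x\<close> stays below \<open>L x\<close> on some interval to the right of
  \<open>x\<close>, where \<open>L\<close> is at least \<open>L x\<close>; on that interval the scaled transform of \<open>L\<close> grows
  strictly faster. This is the uniqueness that makes the Kendall convolution well defined.
\<close>
lemma williamson_inject:
  assumes "\<alpha> > 0" and K1: "nonneg_df K1" and K2: "nonneg_df K2"
    and eq: "\<And>x. x > 0 \<Longrightarrow> williamson \<alpha> K1 x = williamson \<alpha> K2 x"
  shows "K1 = K2"
proof -
  have False if J: "nonneg_df J" and L: "nonneg_df L" and "J x < L x"
    and eq: "\<And>x. x > 0 \<Longrightarrow> scaled_williamson \<alpha> J x = scaled_williamson \<alpha> L x" for J L x
  proof -
    have "x \<ge> 0" using J L \<open>J x < L x\<close> unfolding nonneg_df_def by (metis linorder_not_less order_less_irrefl)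
    have "(J \<longlongrightarrow> J x) (at_right x)"
      using J by (auto simp: nonneg_df_def continuous_within)
    then have "eventually (\<lambda>s. J s < L x) (at_right x)"
      using \<open>J x < L x\<close> by (rule order_tendstoD)
    then obtain b where "b > x" and b: "\<And>s. x < s \<Longrightarrow> s < b \<Longrightarrow> J s < L x"
      by (auto simp: eventually_at_right_field)
    obtain t where t: "x < t" "t < b" using \<open>b > x\<close> dense by blast
    obtain s where s: "x < s" "s < t" using t(1) dense by blast
    have "0 < s" using s \<open>x \<ge> 0\<close> by simp
    have pos: "t powr \<alpha> - s powr \<alpha> > 0"
      using s \<open>0 < s\<close> \<open>\<alpha> > 0\<close> by (simp add: powr_less_mono2)
    have "L s * (t powr \<alpha> - s powr \<alpha>) \<le> J t * (t powr \<alpha> - s powr \<alpha>)"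
      using scaled_williamson_increment(1)[OF L \<open>\<alpha> > 0\<close> \<open>0 < s\<close>, of t]
        scaled_williamson_increment(2)[OF J \<open>\<alpha> > 0\<close> \<open>0 < s\<close>, of t] eq[of s] eq[of t] s \<open>0 < s\<close>
      by simp
    then have "L s \<le> J t" using pos by simp
    moreover have "L x \<le> L s" using L s by (auto simp: nonneg_df_def mono_def)
    moreover have "J t < L x" using b t by blast
    ultimately show False by simp
  qed
  from this[OF K1 K2] this[OF K2 K1] eq have "\<not> K1 x < K2 x" "\<not> K2 x < K1 x" for x
    by (auto simp: scaled_williamson_def)
  then show ?thesis by (auto simp: fun_eq_iff not_less intro: antisym)
qed

text \<open>
  By the increment inequalities, the quotient of the increments of \<open>V\<close> and of \<open>x powr \<alpha>\<close>
  lies between the values of \<open>K\<close> at the two endpoints, hence tends to \<open>K x\<close>.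
\<close>
lemma scaled_williamson_deriv:
  assumes K: "nonneg_df K" and "\<alpha> > 0" "x > 0" and cont: "isCont K x"
  shows "(scaled_williamson \<alpha> K has_real_derivative \<alpha> * x powr (\<alpha> - 1) * K x) (at x)"
proof -
  define p where "p = (\<lambda>b::real. b powr \<alpha>)"
  define V where "V = scaled_williamson \<alpha> K"
  define c where "c = (\<lambda>b. (V b - V x) / (p b - p x))"
  have K_mono: "K s \<le> K t" if "s \<le> t" for s t
    using K that by (auto simp: nonneg_df_def mono_def)
  have p_less: "p s < p t" if "0 < s" "s < t" for s t
    using that \<open>\<alpha> > 0\<close> by (simp add: p_def powr_less_mono2)
  have ev: "eventually (\<lambda>b. b > 0 \<and> b \<noteq> x) (at x)"
    using eventually_at_in_open[of "{0<..}" x] \<open>x > 0\<close> by (auto elim: eventually_mono)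
  have c_bounds: "min (K x) (K b) \<le> c b \<and> c b \<le> max (K x) (K b)" if "b > 0 \<and> b \<noteq> x" for b
  proof (cases "b < x")
    case True
    have pos: "p x - p b > 0" using p_less[of b x] that True by simp
    have "c b = (V x - V b) / (p x - p b)" 
      unfolding c_def by (metis minus_diff_eq minus_divide_divide)
    moreover have "K b \<le> (V x - V b) / (p x - p b)" "(V x - V b) / (p x - p b) \<le> K x"
      using scaled_williamson_increment[OF K \<open>\<alpha> > 0\<close>, of b x] that True pos
      by (simp_all add: V_def p_def field_simps)
    ultimately show ?thesis by linarith
  next
    case False
    have pos: "p b - p x > 0" using p_less[of x b] that False \<open>x > 0\<close> by simp
    have "K x \<le> c b" "c b \<le> K b"
      using scaled_williamson_increment[OF K \<open>\<alpha> > 0\<close>, of x b] that False pos \<open>x > 0\<close>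
      by (simp_all add: V_def p_def c_def field_simps)
    then show ?thesis by linarith
  qed
  have K_lim: "(K \<longlongrightarrow> K x) (at x)" using cont by (simp add: isCont_def)
  have c_lim: "(c \<longlongrightarrow> K x) (at x)"
  proof (rule tendsto_sandwich)
    show "((\<lambda>b. min (K x) (K b)) \<longlongrightarrow> K x) (at x)"
      using tendsto_min[OF tendsto_const K_lim, of "K x"] by simp
    show "((\<lambda>b. max (K x) (K b)) \<longlongrightarrow> K x) (at x)"
      using tendsto_max[OF tendsto_const K_lim, of "K x"] by simp
  qed (use ev c_bounds in \<open>auto elim: eventually_mono\<close>)
  have "(p has_real_derivative \<alpha> * x powr (\<alpha> - 1)) (at x)"
    using \<open>x > 0\<close> unfolding p_def by (auto intro!: derivative_eq_intros)
  then have "((\<lambda>b. (p b - p x) / (b - x)) \<longlongrightarrow> \<alpha> * x powr (\<alpha> - 1)) (at x)"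
    by (simp add: has_field_derivative_iff)
  from tendsto_mult[OF this c_lim]
  have "((\<lambda>b. (V b - V x) / (b - x)) \<longlongrightarrow> \<alpha> * x powr (\<alpha> - 1) * K x) (at x)"
  proof (rule Lim_transform_eventually)
    show "eventually (\<lambda>b. (p b - p x) / (b - x) * c b = (V b - V x) / (b - x)) (at x)"
      using ev
    proof eventually_elim
      case (elim b)
      then have "p b \<noteq> p x" using p_less[of b x] p_less[of x b] \<open>x > 0\<close> by (metis linorder_neqE order_less_irrefl)
      then show ?case by (simp add: c_def)
    qed
  qed
  then show ?thesis by (simp add: has_field_derivative_iff V_def)
qed

lemma scaled_williamson_at_0:
  assumes K: "nonneg_df K" and "\<alpha> > 0"
  shows "(scaled_williamson \<alpha> K \<longlongrightarrow> 0) (at_right 0)"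
proof (rule tendsto_sandwich[where f = "\<lambda>_. 0"])
  show "((\<lambda>x. x powr \<alpha>) \<longlongrightarrow> 0) (at_right (0::real))"
    using \<open>\<alpha> > 0\<close> by real_asymp
  have ev: "eventually (\<lambda>x::real. x > 0) (at_right 0)"
    by (simp add: eventually_at_right_less)
  show "eventually (\<lambda>x. 0 \<le> scaled_williamson \<alpha> K x) (at_right 0)"
    using ev by eventually_elim (rule scaled_williamson_bounds(1)[OF K \<open>\<alpha> > 0\<close>])
  show "eventually (\<lambda>x. scaled_williamson \<alpha> K x \<le> x powr \<alpha>) (at_right 0)"
    using ev
  proof eventually_elim
    case (elim x)
    have "x powr \<alpha> * K x \<le> x powr \<alpha>"
      using nonneg_df_bounds(2)[OF K, of x] by (simp add: mult_left_le)
    with scaled_williamson_bounds(2)[OF K \<open>\<alpha> > 0\<close> elim] show ?case by simp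
  qed
qed simp

text \<open>
  The tool for computing a transform: it suffices to exhibit a function with the right
  derivative on the positive axis and with limit 0 at 0.
\<close>
lemma scaled_williamson_eqI:
  assumes K: "nonneg_df K" and "\<alpha> > 0" and cont: "\<And>x. x > 0 \<Longrightarrow> isCont K x"
    and W: "\<And>x. x > 0 \<Longrightarrow> (W has_real_derivative \<alpha> * x powr (\<alpha> - 1) * K x) (at x)"
    and W0: "(W \<longlongrightarrow> 0) (at_right 0)"
    and "x > 0"
  shows "scaled_williamson \<alpha> K x = W x"
proof -
  define d where "d = (\<lambda>x. scaled_williamson \<alpha> K x - W x)"
  have "(d has_real_derivative 0) (at t)" if "t > 0" for t
    unfolding d_def
    using DERIV_diff[OF scaled_williamson_deriv[OF K \<open>\<alpha> > 0\<close> that cont[OF that]] W[OF that]] by simp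
  then have "(d has_real_derivative 0) (at t within {0<..})" if "t \<in> {0<..}" for t
    using that by (auto intro: has_field_derivative_at_within)
  then obtain c where c: "\<And>t. t > 0 \<Longrightarrow> d t = c"
    using has_field_derivative_zero_constant[of "{0<..}" d] by (metis convex_real_interval(3) greaterThan_iff)
  have "(d \<longlongrightarrow> 0) (at_right 0)"
    unfolding d_def using tendsto_diff[OF scaled_williamson_at_0[OF K \<open>\<alpha> > 0\<close>] W0] by simp
  moreover have "(d \<longlongrightarrow> c) (at_right 0)"
    by (rule tendsto_eventually) (use c in \<open>auto simp: eventually_at_filter\<close>)
  ultimately have "c = 0"
    using tendsto_unique trivial_limit_at_right_real by blast
  with c[OF \<open>x > 0\<close>] show ?thesis by (simp add: d_def)
qed

section \<open>Convolution powers in closed form\<close>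

text \<open>
  The transform \<open>G\<close> of a continuous \<open>F\<close> satisfies \<open>F = G + x * G' / \<alpha>\<close>. Inserting
  \<open>G ^ n\<close> for \<open>G\<close> in this inversion formula and eliminating \<open>G'\<close> gives
  \<open>G ^ n + n * G ^ (n - 1) * (F - G)\<close> for the distribution function of the \<open>n\<close>-fold power,
  which is the following expression with \<open>g = G x\<close> and \<open>u = F x\<close>. The subtraction in
  \<open>real n - 1\<close> is real, so that \<open>n = 0\<close> yields 1.
\<close>
definition kendall_mix :: "nat \<Rightarrow> real \<Rightarrow> real \<Rightarrow> real" where
  "kendall_mix n g u = real n * g ^ (n - 1) * u - (real n - 1) * g ^ n"

lemma kendall_mix_diagonal: "kendall_mix n u u = u ^ n"
  by (cases n) (simp_all add: kendall_mix_def algebra_simps)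

text \<open>
  The derivative in \<open>g\<close> is \<open>n * (n - 1) * g ^ (n - 2) * (u - g)\<close>, which is nonnegative as
  long as \<open>g\<close> does not exceed \<open>u\<close>.
\<close>
lemma kendall_mix_mono_left:
  assumes "0 \<le> g" "g \<le> h" "h \<le> u"
  shows "kendall_mix n g u \<le> kendall_mix n h u"
proof (cases n)
  case 0
  then show ?thesis by (simp add: kendall_mix_def)
next
  case (Suc k)
  \<comment> \<open>the case \<open>u = h\<close>, an instance of the weighted inequality between arithmetic and geometric means\<close>
  have key: "0 \<le> h ^ (k + 1) - real (k + 1) * h * g ^ k + real k * g ^ (k + 1)" for k
  proof (induction k)
    case 0
    then show ?case by simp
  next
    case (Suc k)
    have "h ^ (Suc k + 1) - real (Suc k + 1) * h * g ^ Suc k + real (Suc k) * g ^ (Suc k + 1)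
        = h * (h ^ (k + 1) - real (k + 1) * h * g ^ k + real k * g ^ (k + 1))
          + real (k + 1) * g ^ k * (h - g)\<^sup>2"
      by (simp add: algebra_simps power2_eq_square)
    then show ?case using Suc.IH assms by simp
  qed
  have "g ^ k \<le> h ^ k" using assms by (simp add: power_mono)
  then have "0 \<le> real (k + 1) * (u - h) * (h ^ k - g ^ k)"
    using assms by simp
  then have "0 \<le> real (k + 1) * (u - h) * (h ^ k - g ^ k)
      + (h ^ (k + 1) - real (k + 1) * h * g ^ k + real k * g ^ (k + 1))"
    using key[of k] by (rule add_nonneg_nonneg)
  also have "\<dots> = kendall_mix n h u - kendall_mix n g u"
    by (simp add: kendall_mix_def Suc algebra_simps)
  finally show ?thesis by simp
qed

text \<open>
  Monotonicity of the closed form along the curve \<open>x \<mapsto> (G x, F x)\<close>. If \<open>h\<close> exceeds \<open>u\<close>, the one-variable monotonicity does not apply directly,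
  and the comparison passes through the diagonal values \<open>u ^ n\<close> and \<open>h ^ n\<close>.
\<close>
lemma kendall_mix_mono:
  assumes "0 \<le> g" "g \<le> h" "g \<le> u" "u \<le> v" "h \<le> v"
  shows "kendall_mix n g u \<le> kendall_mix n h v"
proof -
  have right: "kendall_mix n k s \<le> kendall_mix n k t" if "0 \<le> k" "s \<le> t" for k s t
    using that by (simp add: kendall_mix_def mult_left_mono)
  show ?thesis
  proof (cases "h \<le> u")
    case True
    then show ?thesis
      using kendall_mix_mono_left[OF \<open>0 \<le> g\<close> \<open>g \<le> h\<close>, of u n] right[of h u v] assms by linarith
  next
    case False
    have "kendall_mix n g u \<le> u ^ n"
      using kendall_mix_mono_left[of g u u n] assms by (simp add: kendall_mix_diagonal)
    also have "\<dots> \<le> h ^ n" using False assms by (intro power_mono) auto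
    also have "\<dots> \<le> kendall_mix n h v"
      using right[of h h v] assms by (simp add: kendall_mix_diagonal)
    finally show ?thesis .
  qed
qed

definition kendall_power_form :: "real \<Rightarrow> (real \<Rightarrow> real) \<Rightarrow> nat \<Rightarrow> real \<Rightarrow> real" where
  "kendall_power_form \<alpha> F n x = (if x < 0 then 0 else kendall_mix n (williamson \<alpha> F x) (F x))"

lemma williamson_at_0: "nonneg_df F \<Longrightarrow> williamson \<alpha> F 0 = F 0"
proof -
  assume F: "nonneg_df F"
  have "williamson \<alpha> F 0 = (LINT t|interval_measure F. indicator {0..0} t)"
    unfolding williamson_def set_lebesgue_integral_def
    by (rule Bochner_Integration.integral_cong) (auto simp: indicator_def)
  also have "\<dots> = measure (interval_measure F) {0..0}"
    by simp
  also have "\<dots> = F 0" using measure_Icc_nonneg_df[OF F, of 0] by simp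
  finally show ?thesis .
qed

lemma williamson_bounds:
  assumes F: "nonneg_df F" and "\<alpha> > 0" "x \<ge> 0"
  shows "0 \<le> williamson \<alpha> F x" "williamson \<alpha> F x \<le> F x"
proof -
  have "0 \<le> williamson \<alpha> F x \<and> williamson \<alpha> F x \<le> F x"
  proof (cases "x = 0")
    case True
    then show ?thesis using williamson_at_0[OF F] nonneg_df_bounds(1)[OF F] by simp
  next
    case False
    then have "x > 0" using \<open>x \<ge> 0\<close> by simp
    then have pos: "x powr \<alpha> > 0" by simp
    show ?thesis
      using scaled_williamson_bounds[OF F \<open>\<alpha> > 0\<close> \<open>x > 0\<close>] pos
      by (simp add: scaled_williamson_def zero_le_mult_iff)
  qed
  then show "0 \<le> williamson \<alpha> F x" "williamson \<alpha> F x \<le> F x" by auto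
qed

text \<open>
  From \<open>V z \<ge> V x + F x * (z powr \<alpha> - x powr \<alpha>)\<close> and \<open>F x \<ge> G x\<close>, where
  \<open>V x = x powr \<alpha> * G x\<close>.
\<close>
lemma williamson_mono:
  assumes F: "nonneg_df F" and "\<alpha> > 0" "0 < x" "x \<le> z"
  shows "williamson \<alpha> F x \<le> williamson \<alpha> F z"
proof -
  have "z > 0" using assms by simp
  define d where "d = z powr \<alpha> - x powr \<alpha>"
  have "d \<ge> 0" using assms by (simp add: d_def powr_mono2)
  have "z powr \<alpha> * williamson \<alpha> F x = scaled_williamson \<alpha> F x + williamson \<alpha> F x * d"
    by (simp add: scaled_williamson_def d_def algebra_simps)
  also have "\<dots> \<le> scaled_williamson \<alpha> F x + F x * d"
    using williamson_bounds(2)[OF F \<open>\<alpha> > 0\<close>, of x] \<open>x > 0\<close> \<open>d \<ge> 0\<close> by (simp add: mult_right_mono)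
  also have "\<dots> \<le> z powr \<alpha> * williamson \<alpha> F z"
    using scaled_williamson_increment(1)[OF F \<open>\<alpha> > 0\<close> \<open>x > 0\<close> \<open>x \<le> z\<close>]
    by (simp add: scaled_williamson_def d_def)
  finally show ?thesis using \<open>z > 0\<close> by simp
qed

lemma williamson_at_top:
  assumes F: "nonneg_df F" and "\<alpha> > 0"
  shows "(williamson \<alpha> F \<longlongrightarrow> 1) at_top"
  \<comment> \<open>The lower bound is the increment inequality on \<open>[sqrt x, x]\<close>; any intermediate point that is
      large but small compared to \<open>x\<close> would do.\<close>
proof (rule tendsto_sandwich[where f = "\<lambda>x. F (sqrt x) * (1 - (sqrt x / x) powr \<alpha>)" and h = F])
  have F_lim: "(F \<longlongrightarrow> 1) at_top" using F by (simp add: nonneg_df_def)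
  then show "(F \<longlongrightarrow> 1) at_top" .
  have 1: "((\<lambda>x. F (sqrt x)) \<longlongrightarrow> 1) at_top"
    by (rule filterlim_compose[OF F_lim]) real_asymp
  have 2: "((\<lambda>x. 1 - (sqrt x / x) powr \<alpha>) \<longlongrightarrow> 1) at_top"
    using \<open>\<alpha> > 0\<close> by real_asymp
  show "((\<lambda>x. F (sqrt x) * (1 - (sqrt x / x) powr \<alpha>)) \<longlongrightarrow> 1) at_top"
    using tendsto_mult[OF 1 2] by simp
  show "eventually (\<lambda>x. williamson \<alpha> F x \<le> F x) at_top"
    using eventually_ge_at_top[of 0] by eventually_elim (rule williamson_bounds(2)[OF F \<open>\<alpha> > 0\<close>])
  show "eventually (\<lambda>x. F (sqrt x) * (1 - (sqrt x / x) powr \<alpha>) \<le> williamson \<alpha> F x) at_top"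
    using eventually_ge_at_top[of 1]
  proof eventually_elim
    case (elim x)
    then have *: "0 < sqrt x" "sqrt x \<le> x" "0 < x" by (simp_all add: real_sqrt_le_iff' sqrt_le_D real_le_lsqrt power2_eq_square)
    have "F (sqrt x) * (x powr \<alpha> - sqrt x powr \<alpha>) \<le> x powr \<alpha> * williamson \<alpha> F x"
      using scaled_williamson_increment(1)[OF F \<open>\<alpha> > 0\<close> *(1,2)] scaled_williamson_bounds(1)[OF F \<open>\<alpha> > 0\<close> *(1)]
      by (simp add: scaled_williamson_def)
    moreover have "F (sqrt x) * (x powr \<alpha> - sqrt x powr \<alpha>) = x powr \<alpha> * (F (sqrt x) * (1 - (sqrt x / x) powr \<alpha>))"
      using * by (simp add: powr_divide field_simps)
    ultimately show ?case using *(3) by simp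
  qed
qed

lemma williamson_deriv:
  assumes F: "nonneg_df F" and "\<alpha> > 0" "x > 0" and "isCont F x"
  shows "(williamson \<alpha> F has_real_derivative \<alpha> / x * (F x - williamson \<alpha> F x)) (at x)"
proof -
  have "((\<lambda>z. scaled_williamson \<alpha> F z * z powr (- \<alpha>)) has_real_derivative
      \<alpha> * x powr (\<alpha> - 1) * F x * x powr (- \<alpha>)
      + scaled_williamson \<alpha> F x * (- \<alpha> * x powr (- \<alpha> - 1))) (at x)"
    using \<open>x > 0\<close>
    by (auto intro!: derivative_eq_intros scaled_williamson_deriv[OF assms])
  also have "\<alpha> * x powr (\<alpha> - 1) * F x * x powr (- \<alpha>)
      + scaled_williamson \<alpha> F x * (- \<alpha> * x powr (- \<alpha> - 1)) = \<alpha> / x * (F x - williamson \<alpha> F x)"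
    using \<open>x > 0\<close> by (simp add: scaled_williamson_def powr_diff powr_minus field_simps)
  finally show ?thesis
  proof (rule DERIV_cong_ev[THEN iffD1, rotated -1])
    show "eventually (\<lambda>z. scaled_williamson \<alpha> F z * z powr (- \<alpha>) = williamson \<alpha> F z) (nhds x)"
      using eventually_nhds_in_open[of "{0<..}" x] \<open>x > 0\<close>
      by (auto elim!: eventually_mono simp: scaled_williamson_def powr_minus)
  qed simp_all
qed

lemma williamson_right_continuous:
  assumes F: "nonneg_df F" and "\<alpha> > 0" "x \<ge> 0" and cont: "\<And>x. isCont F x" and "F 0 = 0"
  shows "(williamson \<alpha> F \<longlongrightarrow> williamson \<alpha> F x) (at_right x)"
proof (cases "x = 0")
  case True
  have "(williamson \<alpha> F \<longlongrightarrow> 0) (at_right 0)"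
  proof (rule tendsto_sandwich[where f = "\<lambda>_. 0" and h = F])
    show "(F \<longlongrightarrow> 0) (at_right 0)"
      using cont[of 0] \<open>F 0 = 0\<close> by (metis filterlim_at_split isCont_def)
    show "eventually (\<lambda>x. 0 \<le> williamson \<alpha> F x) (at_right 0)" "eventually (\<lambda>x. williamson \<alpha> F x \<le> F x) (at_right 0)"
      using williamson_bounds[OF F \<open>\<alpha> > 0\<close>] by (auto simp: eventually_at_filter)
  qed simp
  then show ?thesis using True williamson_at_0[OF F] \<open>F 0 = 0\<close> by simp
next
  case False
  then have "isCont (williamson \<alpha> F) x"
    using DERIV_isCont[OF williamson_deriv[OF F \<open>\<alpha> > 0\<close> _ cont]] \<open>x \<ge> 0\<close> by simp
  then show ?thesis by (metis filterlim_at_split isCont_def)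
qed

lemma kendall_power_form_nonneg_df:
  assumes F: "nonneg_df F" and "\<alpha> > 0" and cont: "\<And>x. isCont F x" and "F 0 = 0"
  shows "nonneg_df (kendall_power_form \<alpha> F n)"
proof -
  let ?G = "williamson \<alpha> F"
  have F_mono: "F s \<le> F t" if "s \<le> t" for s t
    using F that by (auto simp: nonneg_df_def mono_def)
  note bounds = williamson_bounds[OF F \<open>\<alpha> > 0\<close>]
  have nonneg: "0 \<le> kendall_mix n (?G x) (F x)" if "x \<ge> 0" for x
  proof -
    have "0 \<le> kendall_mix n 0 0" by (simp add: kendall_mix_diagonal)
    also have "\<dots> \<le> kendall_mix n (?G x) (F x)"
      using bounds[OF that] by (intro kendall_mix_mono) auto
    finally show ?thesis .
  qed
  have mono: "mono (kendall_power_form \<alpha> F n)"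
  proof (rule monoI)
    fix x z :: real assume "x \<le> z"
    have "kendall_mix n (?G x) (F x) \<le> kendall_mix n (?G z) (F z)" if "x \<ge> 0"
    proof (rule kendall_mix_mono)
      show "?G x \<le> ?G z"
        using williamson_mono[OF F \<open>\<alpha> > 0\<close> _ \<open>x \<le> z\<close>] williamson_at_0[OF F, of \<alpha>] \<open>F 0 = 0\<close>
          bounds(1)[of z] that \<open>x \<le> z\<close> by (cases "x = 0") auto
    qed (use that \<open>x \<le> z\<close> bounds[of x] bounds[of z] F_mono in auto)
    then show "kendall_power_form \<alpha> F n x \<le> kendall_power_form \<alpha> F n z"
      using nonneg[of z] \<open>x \<le> z\<close> by (auto simp: kendall_power_form_def)
  qed
  have rc: "continuous (at_right x) (kendall_power_form \<alpha> F n)" for x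
  proof (cases "x < 0")
    case True
    have "eventually (\<lambda>t. t < 0) (at_right x)"
      using True eventually_at_right_field by blast
    then have "eventually (\<lambda>t. kendall_power_form \<alpha> F n t = 0) (at_right x)"
      by eventually_elim (simp add: kendall_power_form_def)
    then show ?thesis
      unfolding continuous_within using True
      by (intro tendsto_eventually) (simp add: kendall_power_form_def)
  next
    case False
    have "(F \<longlongrightarrow> F x) (at_right x)"
      using cont[of x] by (metis filterlim_at_split isCont_def)
    then have "((\<lambda>t. kendall_mix n (?G t) (F t)) \<longlongrightarrow> kendall_mix n (?G x) (F x)) (at_right x)"
      unfolding kendall_mix_def
      using williamson_right_continuous[OF F \<open>\<alpha> > 0\<close> _ cont \<open>F 0 = 0\<close>, of x] False
      by (intro tendsto_intros) auto
    then have "(kendall_power_form \<alpha> F n \<longlongrightarrow> kendall_mix n (?G x) (F x)) (at_right x)"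
      by (rule Lim_transform_eventually)
         (use False in \<open>auto simp: eventually_at_filter kendall_power_form_def\<close>)
    then show ?thesis
      unfolding continuous_within using False by (simp add: kendall_power_form_def)
  qed
  have "((\<lambda>x. kendall_mix n (?G x) (F x)) \<longlongrightarrow> kendall_mix n 1 1) at_top"
    unfolding kendall_mix_def
    using williamson_at_top[OF F \<open>\<alpha> > 0\<close>] F by (intro tendsto_intros) (auto simp: nonneg_df_def)
  then have top: "(kendall_power_form \<alpha> F n \<longlongrightarrow> 1) at_top"
    unfolding kendall_mix_diagonal power_one
    by (rule Lim_transform_eventually)
       (use eventually_ge_at_top[of 0] in \<open>eventually_elim, simp add: kendall_power_form_def\<close>)
  show ?thesis
    unfolding nonneg_df_def using mono rc top by (auto simp: kendall_power_form_def)
qed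

text \<open>
  Both sides, multiplied by \<open>x powr \<alpha>\<close>, have the derivative
  \<open>\<alpha> * x powr (\<alpha> - 1) * kendall_power_form \<alpha> F n x\<close>, by the inversion formula that
  motivated the closed form.
\<close>
lemma williamson_kendall_power_form:
  assumes F: "nonneg_df F" and "\<alpha> > 0" and cont: "\<And>x. isCont F x" and "F 0 = 0" and "x > 0"
  shows "williamson \<alpha> (kendall_power_form \<alpha> F n) x = williamson \<alpha> F x ^ n"
proof -
  let ?G = "williamson \<alpha> F" and ?P = "kendall_power_form \<alpha> F n"
  note P = kendall_power_form_nonneg_df[OF F \<open>\<alpha> > 0\<close> cont \<open>F 0 = 0\<close>, of n]
  have G_deriv: "(?G has_real_derivative \<alpha> / t * (F t - ?G t)) (at t)" if "t > 0" for t
    by (rule williamson_deriv[OF F \<open>\<alpha> > 0\<close> that cont])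
  have "scaled_williamson \<alpha> ?P x = x powr \<alpha> * ?G x ^ n"
  proof (rule scaled_williamson_eqI[OF P \<open>\<alpha> > 0\<close> _ _ _ \<open>x > 0\<close>])
    fix t :: real assume "t > 0"
    have c: "isCont (\<lambda>t. kendall_mix n (?G t) (F t)) t"
      unfolding kendall_mix_def
      using DERIV_isCont[OF G_deriv[OF \<open>t > 0\<close>]] cont[of t] by (intro continuous_intros)
    have ev: "eventually (\<lambda>s. kendall_mix n (?G s) (F s) = ?P s) (nhds t)"
      using eventually_nhds_in_open[of "{0<..}" t] \<open>t > 0\<close>
      by (auto elim!: eventually_mono simp: kendall_power_form_def)
    show "isCont ?P t" using c isCont_cong[OF ev] by simp
    have "((\<lambda>t. t powr \<alpha> * ?G t ^ n) has_real_derivative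
       \<alpha> * t powr (\<alpha> - 1) * ?G t ^ n
         + t powr \<alpha> * (real n * ?G t ^ (n - 1) * (\<alpha> / t * (F t - ?G t)))) (at t)"
      using \<open>t > 0\<close> by (auto intro!: derivative_eq_intros G_deriv)
    also have "\<alpha> * t powr (\<alpha> - 1) * ?G t ^ n
         + t powr \<alpha> * (real n * ?G t ^ (n - 1) * (\<alpha> / t * (F t - ?G t)))
       = \<alpha> * t powr (\<alpha> - 1) * ?P t"
      using \<open>t > 0\<close>
      by (cases n) (simp_all add: kendall_power_form_def kendall_mix_def powr_diff field_simps)
    finally show "((\<lambda>t. t powr \<alpha> * ?G t ^ n) has_real_derivative \<alpha> * t powr (\<alpha> - 1) * ?P t) (at t)" .
  next
    show "((\<lambda>t. t powr \<alpha> * ?G t ^ n) \<longlongrightarrow> 0) (at_right 0)"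
    proof (rule tendsto_sandwich[where f = "\<lambda>_. 0"])
      show "((\<lambda>x. x powr \<alpha>) \<longlongrightarrow> 0) (at_right (0::real))"
        using \<open>\<alpha> > 0\<close> by real_asymp
      have "0 \<le> t powr \<alpha> * ?G t ^ n \<and> t powr \<alpha> * ?G t ^ n \<le> t powr \<alpha>" if "t > 0" for t
      proof -
        have "0 \<le> ?G t" "?G t \<le> 1"
          using williamson_bounds[OF F \<open>\<alpha> > 0\<close>, of t] nonneg_df_bounds(2)[OF F, of t] that by auto
        then show ?thesis by (simp add: power_le_one mult_left_le)
      qed
      then show "eventually (\<lambda>t. 0 \<le> t powr \<alpha> * ?G t ^ n) (at_right 0)"
          "eventually (\<lambda>t. t powr \<alpha> * ?G t ^ n \<le> t powr \<alpha>) (at_right 0)"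
        by (auto simp: eventually_at_filter)
    qed simp
  qed
  then show ?thesis using \<open>x > 0\<close> by (simp add: scaled_williamson_def)
qed

lemma kendall_power_eq_form:
  assumes F: "nonneg_df F" and "\<alpha> > 0" and cont: "\<And>x. isCont F x" and "F 0 = 0"
  shows "kendall_power \<alpha> F n = kendall_power_form \<alpha> F n"
proof (induction n)
  case 0
  show ?case by (auto simp: kendall_power_form_def kendall_mix_def)
next
  case (Suc n)
  note df = kendall_power_form_nonneg_df[OF F \<open>\<alpha> > 0\<close> cont \<open>F 0 = 0\<close>]
  note wt = williamson_kendall_power_form[OF F \<open>\<alpha> > 0\<close> cont \<open>F 0 = 0\<close>]
  show ?case
    unfolding kendall_power.simps Suc.IH kendall_conv_def
  proof (rule the_equality)
    show "nonneg_df (kendall_power_form \<alpha> F (Suc n)) \<and>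
        (\<forall>x>0. williamson \<alpha> (kendall_power_form \<alpha> F (Suc n)) x
          = williamson \<alpha> (kendall_power_form \<alpha> F n) x * williamson \<alpha> F x)"
      using df wt by simp
  next
    fix K
    assume K: "nonneg_df K \<and> (\<forall>x>0. williamson \<alpha> K x
          = williamson \<alpha> (kendall_power_form \<alpha> F n) x * williamson \<alpha> F x)"
    then show "K = kendall_power_form \<alpha> F (Suc n)"
      using wt by (intro williamson_inject[OF \<open>\<alpha> > 0\<close> _ df]) simp_all
  qed
qed

section \<open>The renewal function\<close>

lemma kendall_renewal_closed_form:
  assumes F: "nonneg_df F" and "\<alpha> > 0" and cont: "\<And>x. isCont F x" and "F 0 = 0"
    and "x \<ge> 0" and less: "williamson \<alpha> F x < 1"
  shows "kendall_renewal \<alpha> F x =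
    2 / (1 - williamson \<alpha> F x) - (1 - F x) / (1 - williamson \<alpha> F x)\<^sup>2"
proof -
  define g where "g = williamson \<alpha> F x"
  have g: "0 \<le> g" "g < 1"
    using williamson_bounds(1)[OF F \<open>\<alpha> > 0\<close> \<open>x \<ge> 0\<close>] less by (simp_all add: g_def)
  have d: "(\<lambda>n. real (Suc n) * g ^ n) sums (1 / (1 - g)\<^sup>2)"
    using geometric_deriv_sums[of g] g by simp
  have "(\<lambda>n. real n * g ^ (n - 1)) sums (1 / (1 - g)\<^sup>2)"
    using d sums_Suc_iff[of "\<lambda>n. real n * g ^ (n - 1)" "1 / (1 - g)\<^sup>2"] by simp
  moreover have "(\<lambda>n. g ^ n) sums (1 / (1 - g))"
    using g by (intro geometric_sums) simp
  ultimately have "(\<lambda>n. real n * g ^ (n - 1) * F x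
      - (real (Suc n) * g ^ n - 2 * g ^ n)) sums
      (1 / (1 - g)\<^sup>2 * F x - (1 / (1 - g)\<^sup>2 - 2 * (1 / (1 - g))))"
    using d by (intro sums_diff sums_mult sums_mult2)
  then have "(\<lambda>n. kendall_mix n g (F x)) sums
      (1 / (1 - g)\<^sup>2 * F x - (1 / (1 - g)\<^sup>2 - 2 * (1 / (1 - g))))"
    by (simp add: kendall_mix_def algebra_simps)
  then have "(\<lambda>n. kendall_power \<alpha> F n x) sums
      (1 / (1 - g)\<^sup>2 * F x - (1 / (1 - g)\<^sup>2 - 2 * (1 / (1 - g))))"
    using \<open>x \<ge> 0\<close> unfolding kendall_power_eq_form[OF F \<open>\<alpha> > 0\<close> cont \<open>F 0 = 0\<close>]
    by (simp add: kendall_power_form_def g_def)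
  then have "kendall_renewal \<alpha> F x = 1 / (1 - g)\<^sup>2 * F x - (1 / (1 - g)\<^sup>2 - 2 * (1 / (1 - g)))"
    unfolding kendall_renewal_def by (rule sums_unique[symmetric])
  also have "\<dots> = 2 / (1 - g) - (1 - F x) / (1 - g)\<^sup>2"
    by (simp add: diff_divide_distrib)
  finally show ?thesis by (simp add: g_def)
qed

lemma kendall_renewal_scaled:
  fixes \<alpha> :: real and F :: "real \<Rightarrow> real"
  defines "H \<equiv> (\<lambda>x. x powr \<alpha> - scaled_williamson \<alpha> F x)"
  assumes F: "nonneg_df F" and "\<alpha> > 0" and cont: "\<And>x. isCont F x" and "F 0 = 0"
    and "x > 0" and "H x > 0"
  shows "kendall_renewal \<alpha> F x = 2 * x powr \<alpha> / H x - (x powr \<alpha>)\<^sup>2 * (1 - F x) / (H x)\<^sup>2"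
proof -
  have pos: "x powr \<alpha> > 0" using \<open>x > 0\<close> by simp
  have H_eq: "H x = x powr \<alpha> * (1 - williamson \<alpha> F x)"
    by (simp add: H_def scaled_williamson_def algebra_simps)
  then have less: "williamson \<alpha> F x < 1" using \<open>H x > 0\<close> pos by (simp add: zero_less_mult_iff)
  show ?thesis
    unfolding kendall_renewal_closed_form[OF F \<open>\<alpha> > 0\<close> cont \<open>F 0 = 0\<close> less_imp_le[OF \<open>x > 0\<close>] less] H_eq
    using pos less by (simp add: power_mult_distrib)
qed

text \<open>
  The analytic core. Each term of the increment of
  \<open>2 * x powr \<alpha> / H x - (x powr \<alpha>)\<^sup>2 * (1 - F x) / (H x)\<^sup>2\<close> is decomposed into
  increments of \<open>x powr \<alpha>\<close>, of \<open>H\<close> and of \<open>1 - F\<close>. After division by \<open>x powr (\<alpha> - 1)\<close>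
  only the increment of \<open>x powr \<alpha>\<close> in the first term survives: the increment of \<open>H\<close> is at most
  \<open>1 - F x\<close> times that of \<open>x powr \<alpha>\<close>, so it is killed by the tail assumption, and the
  increment of \<open>1 - F\<close> in the second term carries the weight \<open>x powr (\<alpha> + 1)\<close> of the
  last assumption.
\<close>
lemma kendall_renewal_increment_limit:
  fixes \<alpha> y m :: real and F :: "real \<Rightarrow> real"
  defines "H \<equiv> (\<lambda>x. x powr \<alpha> - scaled_williamson \<alpha> F x)"
  assumes F: "nonneg_df F" and "\<alpha> > 0" and cont: "\<And>x. isCont F x" and "F 0 = 0"
    and "y > 0" "m > 0"
    and H_lim: "(H \<longlongrightarrow> m) at_top"
    and tail: "((\<lambda>x. x powr \<alpha> * (1 - F x)) \<longlongrightarrow> 0) at_top"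
    and tail_diff: "((\<lambda>x. x powr (\<alpha> + 1) * ((1 - F (x + y)) - (1 - F x))) \<longlongrightarrow> 0) at_top"
  shows "((\<lambda>x. 1 / x powr (\<alpha> - 1) * (kendall_renewal \<alpha> F (x + y) - kendall_renewal \<alpha> F x))
          \<longlongrightarrow> 2 * \<alpha> / m * y) at_top"
proof -
  \<comment> \<open>The building blocks of the decomposition: normalised increments of \<open>x powr \<alpha>\<close> (\<open>q\<close>), of \<open>H\<close> (\<open>w\<close>)
      and of the tail (\<open>d\<close>), together with the ratio \<open>r\<close> and the scaled tail \<open>u\<close>.\<close>
  define q where "q = (\<lambda>x. ((x + y) powr \<alpha> - x powr \<alpha>) / x powr (\<alpha> - 1))"
  define r where "r = (\<lambda>x. (x + y) powr \<alpha> / x powr \<alpha>)"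
  define u where "u = (\<lambda>x. x powr \<alpha> * (1 - F x))"
  define w where "w = (\<lambda>x. x powr \<alpha> * (H (x + y) - H x) / x powr (\<alpha> - 1))"
  define d where "d = (\<lambda>x. x powr (\<alpha> + 1) * ((1 - F (x + y)) - (1 - F x)))"
  define K where "K = (\<lambda>x. H (x + y))"
  have q: "(q \<longlongrightarrow> \<alpha> * y) at_top"
    unfolding q_def using \<open>y > 0\<close> \<open>\<alpha> > 0\<close> by real_asymp
  have r: "(r \<longlongrightarrow> 1) at_top"
    unfolding r_def using \<open>y > 0\<close> \<open>\<alpha> > 0\<close> by real_asymp
  have u: "(u \<longlongrightarrow> 0) at_top" using tail by (simp add: u_def)
  have d: "(d \<longlongrightarrow> 0) at_top" using tail_diff by (simp add: d_def)
  have "filterlim (\<lambda>x. x + y) at_top at_top" by real_asymp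
  from filterlim_compose[OF H_lim this] have K: "(K \<longlongrightarrow> m) at_top" by (simp add: K_def)
  have w: "(w \<longlongrightarrow> 0) at_top"
  proof (rule tendsto_sandwich[where f = "\<lambda>_. 0" and h = "\<lambda>x. u x * q x"])
    show "((\<lambda>x. u x * q x) \<longlongrightarrow> 0) at_top" using tendsto_mult[OF u q] by simp
    have "0 \<le> w x \<and> w x \<le> u x * q x" if "x > 0" for x
    proof -
      define D where "D = (x + y) powr \<alpha> - x powr \<alpha>"
      note V = scaled_williamson_increment[OF F \<open>\<alpha> > 0\<close> that, of "x + y"]
      have "D \<ge> 0" using that \<open>y > 0\<close> \<open>\<alpha> > 0\<close> by (simp add: D_def powr_mono2)
      then have "F (x + y) * D \<le> D"
        using nonneg_df_bounds(2)[OF F] by (simp add: mult_left_le_one_le nonneg_df_bounds[OF F])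
      then have H: "0 \<le> H (x + y) - H x" "H (x + y) - H x \<le> (1 - F x) * D"
        using V \<open>y > 0\<close> by (simp_all add: H_def D_def algebra_simps)
      have "x powr \<alpha> * (H (x + y) - H x) \<le> x powr \<alpha> * ((1 - F x) * D)"
        using H(2) by (simp add: mult_left_mono)
      then have "w x \<le> x powr \<alpha> * ((1 - F x) * D) / x powr (\<alpha> - 1)"
        unfolding w_def by (simp add: divide_right_mono)
      also have "\<dots> = u x * q x" by (simp add: u_def q_def D_def)
      finally show ?thesis using H(1) by (simp add: w_def)
    qed
    then show "eventually (\<lambda>x. 0 \<le> w x) at_top" "eventually (\<lambda>x. w x \<le> u x * q x) at_top"
      by (auto intro: eventually_mono[OF eventually_gt_at_top[of 0]])
  qed simp
  have "((\<lambda>x. 2 * q x / K x - 2 * w x / (H x * K x)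
      - ((r x)\<^sup>2 * d x / (K x)\<^sup>2 + u x * q x * (r x + 1) / (K x)\<^sup>2
         - u x * w x * (H x + K x) / ((H x)\<^sup>2 * (K x)\<^sup>2))) \<longlongrightarrow>
      2 * (\<alpha> * y) / m - 2 * 0 / (m * m) - (1\<^sup>2 * 0 / m\<^sup>2 + 0 * (\<alpha> * y) * (1 + 1) / m\<^sup>2
         - 0 * 0 * (m + m) / (m\<^sup>2 * m\<^sup>2))) at_top"
    using \<open>m > 0\<close> by (intro tendsto_intros q r u d K w H_lim) auto
  then have "((\<lambda>x. 2 * q x / K x - 2 * w x / (H x * K x)
      - ((r x)\<^sup>2 * d x / (K x)\<^sup>2 + u x * q x * (r x + 1) / (K x)\<^sup>2
         - u x * w x * (H x + K x) / ((H x)\<^sup>2 * (K x)\<^sup>2))) \<longlongrightarrow> 2 * \<alpha> / m * y) at_top"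
    by (simp add: mult.assoc)
  then show ?thesis
  proof (rule Lim_transform_eventually)
    have "eventually (\<lambda>x. x > 0 \<and> H x > 0 \<and> K x > 0) at_top"
      using eventually_gt_at_top[of 0] order_tendstoD(1)[OF H_lim \<open>m > 0\<close>] order_tendstoD(1)[OF K \<open>m > 0\<close>]
      by eventually_elim simp
    then show "eventually (\<lambda>x. 2 * q x / K x - 2 * w x / (H x * K x)
      - ((r x)\<^sup>2 * d x / (K x)\<^sup>2 + u x * q x * (r x + 1) / (K x)\<^sup>2
         - u x * w x * (H x + K x) / ((H x)\<^sup>2 * (K x)\<^sup>2)) =
      1 / x powr (\<alpha> - 1) * (kendall_renewal \<alpha> F (x + y) - kendall_renewal \<alpha> F x)) at_top"
    proof eventually_elim
      case (elim x)
      define A A' T T' where "A = x powr \<alpha>" and "A' = (x + y) powr \<alpha>"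
        and "T = 1 - F x" and "T' = 1 - F (x + y)"
      have "A > 0" using elim by (simp add: A_def)
      have S: "x powr (\<alpha> - 1) = A / x" "x powr (\<alpha> + 1) = A * x"
        using elim by (simp_all add: A_def powr_diff powr_add)
      have R: "kendall_renewal \<alpha> F x = 2 * A / H x - A\<^sup>2 * T / (H x)\<^sup>2"
        "kendall_renewal \<alpha> F (x + y) = 2 * A' / K x - A'\<^sup>2 * T' / (K x)\<^sup>2"
        using kendall_renewal_scaled[OF F \<open>\<alpha> > 0\<close> cont \<open>F 0 = 0\<close>] elim \<open>y > 0\<close>
        by (simp_all add: H_def K_def A_def A'_def T_def T'_def)
      have qw: "q x = (A' - A) / (A / x)" "r x = A' / A" "u x = A * T"
          "w x = A * (K x - H x) / (A / x)" "d x = A * x * (T' - T)"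
        by (simp_all add: q_def r_def u_def w_def d_def K_def S A_def[symmetric] A'_def[symmetric] T_def T'_def)
      have nz: "x \<noteq> 0" "A \<noteq> 0" "H x \<noteq> 0" "K x \<noteq> 0" using elim \<open>A > 0\<close> by auto
      show ?case unfolding R qw S using nz by (simp add: field_simps power2_eq_square)
    qed
  qed
qed

section \<open>Tail and truncated moments\<close>

text \<open>
  Eventually \<open>f t \<le> (\<beta> + 1) * (1 - F t) / t\<close>, so the mass of an interval of length \<open>y\<close>
  beginning at \<open>x\<close> is of order \<open>(1 - F x) / x\<close>, which \<open>x powr (\<alpha> + 1)\<close> turns into the
  scaled tail. A positive limit of the ratio also excludes \<open>F x = 1\<close> for large \<open>x\<close>, where the
  quotient would be 0.
\<close>
lemma density_tail_increment_limit:
  fixes f F :: "real \<Rightarrow> real" and D :: "real measure"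
  assumes "\<alpha> > 0" "\<beta> > 0" "y > 0" and "real_distribution D" and D: "D = density lborel (\<lambda>x. ennreal (f x))"
    and [measurable]: "f \<in> borel_measurable borel" and f: "\<And>x. f x \<ge> 0"
    and F: "F = cdf D"
    and ratio: "((\<lambda>x. x * f x / (1 - F x)) \<longlongrightarrow> \<beta>) at_top"
    and tail: "((\<lambda>x. x powr \<alpha> * (1 - F x)) \<longlongrightarrow> 0) at_top"
  shows "((\<lambda>x. x powr (\<alpha> + 1) * ((1 - F (x + y)) - (1 - F x))) \<longlongrightarrow> 0) at_top"
proof -
  interpret real_distribution D by fact
  have F_mono: "F s \<le> F t" if "s \<le> t" for s t
    using cdf_nondecreasing[OF that] by (simp add: F)
  have F_le: "F t \<le> 1" for t using cdf_bounded_prob[of t] by (simp add: F)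
  have "eventually (\<lambda>x. 0 < x * f x / (1 - F x)) at_top" "eventually (\<lambda>x. x * f x / (1 - F x) < \<beta> + 1) at_top"
    using order_tendstoD[OF ratio] \<open>\<beta> > 0\<close> by simp_all
  then have "eventually (\<lambda>x. f x \<le> (\<beta> + 1) * (1 - F x) / x) at_top"
    using eventually_gt_at_top[of 0]
  proof eventually_elim
    case (elim x)
    then have "1 - F x > 0" using F_le[of x] by (cases "F x = 1") auto
    with elim show ?case by (simp add: field_simps)
  qed
  then obtain x0 where x0: "\<And>x. x \<ge> x0 \<Longrightarrow> f x \<le> (\<beta> + 1) * (1 - F x) / x"
    by (auto simp: eventually_at_top_linorder)
  have incr: "F (x + y) - F x \<le> (\<beta> + 1) * (1 - F x) / x * y" if "x \<ge> x0" "x > 0" for x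
  proof -
    define c where "c = (\<beta> + 1) * (1 - F x) / x"
    have "c \<ge> 0" using F_le[of x] \<open>\<beta> > 0\<close> that by (simp add: c_def)
    have f_le: "f t \<le> c" if "x < t" for t
    proof -
      have "f t \<le> (\<beta> + 1) * (1 - F t) / t" using x0[of t] that \<open>x \<ge> x0\<close> by simp
      also have "\<dots> \<le> c" unfolding c_def
        using that \<open>x > 0\<close> F_le[of t] F_mono[of x t] \<open>\<beta> > 0\<close>
        by (intro frac_le mult_left_mono mult_nonneg_nonneg) auto
      finally show ?thesis .
    qed
    have "emeasure D {x<..x+y} = (\<integral>\<^sup>+ t. ennreal (f t) * indicator {x<..x+y} t \<partial>lborel)"
      unfolding D by (simp add: emeasure_density)
    also have "\<dots> \<le> (\<integral>\<^sup>+ t. ennreal c * indicator {x<..x+y} t \<partial>lborel)"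
      using f_le by (intro nn_integral_mono) (auto simp: indicator_def intro: ennreal_leI)
    also have "\<dots> = ennreal (c * y)"
      using \<open>y > 0\<close> \<open>c \<ge> 0\<close> by (simp add: nn_integral_cmult_indicator ennreal_mult)
    finally have "measure D {x<..x+y} \<le> c * y"
      using \<open>c \<ge> 0\<close> \<open>y > 0\<close> by (simp add: emeasure_eq_measure)
    then show ?thesis
      using cdf_diff_eq[of x "x + y"] \<open>y > 0\<close> by (simp add: F c_def)
  qed
  show ?thesis
  proof (rule tendsto_sandwich[where h = "\<lambda>_. 0" and f = "\<lambda>x. - ((\<beta> + 1) * y * (x powr \<alpha> * (1 - F x)))"])
    show "((\<lambda>x. - ((\<beta> + 1) * y * (x powr \<alpha> * (1 - F x)))) \<longlongrightarrow> 0) at_top"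
      using tendsto_minus[OF tendsto_mult_left[OF tail, of "(\<beta> + 1) * y"]] by simp
    show "eventually (\<lambda>x. x powr (\<alpha> + 1) * ((1 - F (x + y)) - (1 - F x)) \<le> 0) at_top"
      using F_mono \<open>y > 0\<close> by (simp add: mult_nonneg_nonpos)
    show "eventually (\<lambda>x. - ((\<beta> + 1) * y * (x powr \<alpha> * (1 - F x)))
        \<le> x powr (\<alpha> + 1) * ((1 - F (x + y)) - (1 - F x))) at_top"
      using eventually_gt_at_top[of 0] eventually_ge_at_top[of x0]
    proof eventually_elim
      case (elim x)
      have "x powr (\<alpha> + 1) * (F (x + y) - F x) \<le> x powr (\<alpha> + 1) * ((\<beta> + 1) * (1 - F x) / x * y)"
        using incr[OF elim(2,1)] by (intro mult_left_mono) simp_all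
      also have "\<dots> = (\<beta> + 1) * y * (x powr \<alpha> * (1 - F x))"
        using elim(1) by (simp add: powr_add)
      finally show ?case by (simp add: algebra_simps)
    qed
  qed simp
qed

lemma (in prob_space) tail_moment_limit:
  assumes [measurable]: "X \<in> borel_measurable M" and "\<alpha> > 0"
    and int: "integrable M (\<lambda>\<omega>. X \<omega> powr \<alpha>)"
  shows "((\<lambda>x. x powr \<alpha> * (1 - cdf (distr M borel X) x)) \<longlongrightarrow> 0) at_top"
proof -
  have "((\<lambda>x. LINT \<omega>|M. x powr \<alpha> * indicator {\<omega>\<in>space M. x < X \<omega>} \<omega>) \<longlongrightarrow> (LINT \<omega>|M. 0)) at_top"
  proof (rule integral_dominated_convergence_at_top[OF _ _ int])
    show "AE \<omega> in M. ((\<lambda>x. x powr \<alpha> * indicator {\<omega> \<in> space M. x < X \<omega>} \<omega>) \<longlongrightarrow> 0) at_top"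
    proof (rule AE_I2)
      fix \<omega>
      show "((\<lambda>x. x powr \<alpha> * indicator {\<omega> \<in> space M. x < X \<omega>} \<omega>) \<longlongrightarrow> 0) at_top"
        by (intro tendsto_eventually eventually_mono[OF eventually_ge_at_top[of "X \<omega>"]])
          (simp add: indicator_def)
    qed
    show "eventually (\<lambda>x. AE \<omega> in M. norm (x powr \<alpha> * indicator {\<omega> \<in> space M. x < X \<omega>} \<omega>) \<le> X \<omega> powr \<alpha>) at_top"
      using eventually_ge_at_top[of 0]
      by eventually_elim (use \<open>\<alpha> > 0\<close> in \<open>auto simp: indicator_def powr_mono2\<close>)
  qed measurable
  moreover have "(LINT \<omega>|M. x powr \<alpha> * indicator {\<omega>\<in>space M. x < X \<omega>} \<omega>)
      = x powr \<alpha> * (1 - cdf (distr M borel X) x)" for x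
  proof -
    have "cdf (distr M borel X) x = prob {\<omega>\<in>space M. X \<omega> \<le> x}"
      by (simp add: cdf_def measure_distr vimage_def Int_def conj_commute)
    also have "1 - \<dots> = prob (space M - {\<omega>\<in>space M. X \<omega> \<le> x})"
      by (simp add: prob_compl)
    also have "space M - {\<omega>\<in>space M. X \<omega> \<le> x} = {\<omega>\<in>space M. x < X \<omega>}" by auto
    finally show ?thesis by simp
  qed
  ultimately show ?thesis by (simp only: Bochner_Integration.integral_zero)
qed

text \<open>
  For positive \<open>X\<close>, \<open>x powr \<alpha> - scaled_williamson \<alpha> F x\<close> is the truncated moment
  \<open>E (min (x powr \<alpha>) (X powr \<alpha>))\<close>, and dominated convergence applies.
\<close>
lemma (in prob_space) truncated_moment_limit:
  fixes \<alpha> :: real and X :: "'a \<Rightarrow> real"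
  defines "F \<equiv> cdf (distr M borel X)"
  assumes [measurable]: "X \<in> borel_measurable M" and "\<alpha> > 0" and pos: "AE \<omega> in M. X \<omega> > 0"
    and int: "integrable M (\<lambda>\<omega>. X \<omega> powr \<alpha>)"
  shows "((\<lambda>x. x powr \<alpha> - scaled_williamson \<alpha> F x) \<longlongrightarrow> (LINT \<omega>|M. X \<omega> powr \<alpha>)) at_top"
proof -
  interpret X: real_distribution "distr M borel X" by simp
  have im: "interval_measure F = distr M borel X"
  proof (rule cdf_unique)
    show "real_distribution (interval_measure F)"
      unfolding F_def using X.cdf_nondecreasing X.cdf_is_right_cont X.cdf_lim_at_bot X.cdf_lim_at_top_prob
      by (intro real_distribution_interval_measure) auto
    show "cdf (interval_measure F) = cdf (distr M borel X)"
      unfolding F_def using X.cdf_nondecreasing X.cdf_is_right_cont X.cdf_lim_at_bot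
      by (intro cdf_interval_measure) auto
  qed (simp add: X.real_distribution_axioms)
  have eq: "x powr \<alpha> - scaled_williamson \<alpha> F x = (LINT \<omega>|M. min (x powr \<alpha>) (X \<omega> powr \<alpha>))"
    if "x > 0" for x
  proof -
    have int1: "integrable M (\<lambda>\<omega>. indicator {0..x} (X \<omega>) * (x powr \<alpha> - X \<omega> powr \<alpha>))"
    proof (rule integrable_const_bound[where B = "x powr \<alpha>"])
      show "AE \<omega> in M. norm (indicator {0..x} (X \<omega>) * (x powr \<alpha> - X \<omega> powr \<alpha>)) \<le> x powr \<alpha>"
        using \<open>\<alpha> > 0\<close> by (auto simp: indicator_def powr_mono2)
    qed measurable
    have "scaled_williamson \<alpha> F x = (LINT \<omega>|M. indicator {0..x} (X \<omega>) * (x powr \<alpha> - X \<omega> powr \<alpha>))"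
      unfolding scaled_williamson_integral[OF that] im by (rule integral_distr) measurable
    then have "x powr \<alpha> - scaled_williamson \<alpha> F x =
        (LINT \<omega>|M. x powr \<alpha> - indicator {0..x} (X \<omega>) * (x powr \<alpha> - X \<omega> powr \<alpha>))"
      using int1 by (simp add: prob_space)
    also have "\<dots> = (LINT \<omega>|M. min (x powr \<alpha>) (X \<omega> powr \<alpha>))"
    proof (rule integral_cong_AE)
      show "AE \<omega> in M. x powr \<alpha> - indicator {0..x} (X \<omega>) * (x powr \<alpha> - X \<omega> powr \<alpha>)
          = min (x powr \<alpha>) (X \<omega> powr \<alpha>)"
        using pos
      proof eventually_elim
        case (elim \<omega>)
        then show ?case
          using powr_mono2[of \<alpha> "X \<omega>" x] powr_mono2[of \<alpha> x "X \<omega>"] \<open>\<alpha> > 0\<close> that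
          by (cases "X \<omega> \<le> x") (auto simp: min_def)
      qed
    qed measurable
    finally show ?thesis .
  qed
  have "((\<lambda>x. LINT \<omega>|M. min (x powr \<alpha>) (X \<omega> powr \<alpha>)) \<longlongrightarrow> (LINT \<omega>|M. X \<omega> powr \<alpha>)) at_top"
  proof (rule integral_dominated_convergence_at_top[OF _ _ int])
    show "AE \<omega> in M. ((\<lambda>x. min (x powr \<alpha>) (X \<omega> powr \<alpha>)) \<longlongrightarrow> X \<omega> powr \<alpha>) at_top"
    proof (rule AE_I2)
      fix \<omega>
      have "filterlim (\<lambda>x::real. x powr \<alpha>) at_top at_top" using \<open>\<alpha> > 0\<close> by real_asymp
      then have "eventually (\<lambda>x. X \<omega> powr \<alpha> \<le> x powr \<alpha>) at_top"
        by (simp add: filterlim_at_top)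
      then show "((\<lambda>x. min (x powr \<alpha>) (X \<omega> powr \<alpha>)) \<longlongrightarrow> X \<omega> powr \<alpha>) at_top"
        by (intro tendsto_eventually) (auto elim: eventually_mono)
    qed
  qed (auto intro!: always_eventually)
  then show ?thesis
    by (rule Lim_transform_eventually)
       (use eventually_gt_at_top[of 0] in \<open>eventually_elim, simp add: eq\<close>)
qed

section \<open>The Blackwell-type renewal theorem\<close>

theorem mainTheorem5:
  fixes M :: "'a measure" and X :: "'a \<Rightarrow> real" and f F :: "real \<Rightarrow> real"
    and \<alpha> \<beta> m y :: real
  assumes "\<alpha> > 0"
    and "prob_space M"
    and "X \<in> borel_measurable M"
    and "AE \<omega> in M. X \<omega> > 0"
    and F: "F = cdf (distr M borel X)"
    and "integrable M (\<lambda>\<omega>. X \<omega> powr \<alpha>)"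
    and m: "m = (LINT \<omega>|M. X \<omega> powr \<alpha>)"
    and "\<And>x. f x \<ge> 0"
    and "distributed M lborel X (\<lambda>x. ennreal (f x))"
    and "((\<lambda>x. x * f x / (1 - F x)) \<longlongrightarrow> \<beta>) at_top"
    and "\<beta> > \<alpha>"
    and "y > 0"
  shows "((\<lambda>x. x powr (\<alpha> + 1) * ((1 - F (x + y)) - (1 - F x))) \<longlongrightarrow> 0) at_top
    \<and> ((\<lambda>x. 1 / x powr (\<alpha> - 1) * (kendall_renewal \<alpha> F (x + y) - kendall_renewal \<alpha> F x))
          \<longlongrightarrow> 2 * \<alpha> / m * y) at_top"
proof -
  interpret prob_space M by fact
  note [measurable] = \<open>X \<in> borel_measurable M\<close>
  interpret X: real_distribution "distr M borel X" by simp
  note int = \<open>integrable M (\<lambda>\<omega>. X \<omega> powr \<alpha>)\<close> and X_pos = \<open>AE \<omega> in M. X \<omega> > 0\<close>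
  have "(\<lambda>x. enn2real (ennreal (f x))) \<in> borel_measurable borel"
    using distributed_borel_measurable[OF \<open>distributed M lborel X _\<close>] by simp
  then have f_meas: "f \<in> borel_measurable borel" using \<open>\<And>x. f x \<ge> 0\<close> by simp
  have dens: "distr M borel X = density lborel (\<lambda>x. ennreal (f x))"
    using distributed_distr_eq_density[OF \<open>distributed M lborel X _\<close>]
    by (metis distr_cong sets_lborel)
  have cont: "isCont F x" for x
  proof -
    have "emeasure (density lborel (\<lambda>x. ennreal (f x))) {x} = 0"
      using f_meas by (subst emeasure_density) (auto simp: nn_integral_0_iff_AE AE_lborel_singleton intro: AE_mp[OF AE_lborel_singleton[of x]])
    then have "measure (distr M borel X) {x} = 0" by (simp add: dens measure_def)
    then show ?thesis unfolding F by (simp add: X.isCont_cdf)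
  qed
  have F_zero: "F x = 0" if "x \<le> 0" for x
  proof -
    have "prob {\<omega>\<in>space M. X \<omega> \<le> x} = 0"
      using X_pos that by (subst prob_eq_0) (auto elim!: eventually_mono)
    then show ?thesis
      by (simp add: F cdf_def measure_distr vimage_def Int_def conj_commute)
  qed
  have df: "nonneg_df F"
    unfolding nonneg_df_def
    using X.cdf_nondecreasing X.cdf_is_right_cont X.cdf_lim_at_top_prob F_zero
    by (auto simp: F mono_def)
  have "m > 0"
  proof -
    have "m \<ge> 0" unfolding m by simp
    moreover have "m \<noteq> 0"
    proof
      assume "m = 0"
      then have "AE \<omega> in M. X \<omega> powr \<alpha> = 0"
        using integral_nonneg_eq_0_iff_AE[OF int] m by simp
      with X_pos have "AE \<omega> in M. False" by eventually_elim simp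
      then show False using AE_False by simp
    qed
    ultimately show ?thesis by simp
  qed
  have tail: "((\<lambda>x. x powr \<alpha> * (1 - F x)) \<longlongrightarrow> 0) at_top"
    unfolding F by (rule tail_moment_limit[OF _ \<open>\<alpha> > 0\<close> int]) measurable
  have tail_diff: "((\<lambda>x. x powr (\<alpha> + 1) * ((1 - F (x + y)) - (1 - F x))) \<longlongrightarrow> 0) at_top"
    using density_tail_increment_limit[OF \<open>\<alpha> > 0\<close> _ \<open>y > 0\<close> X.real_distribution_axioms dens f_meas
        \<open>\<And>x. f x \<ge> 0\<close> F \<open>((\<lambda>x. x * f x / (1 - F x)) \<longlongrightarrow> \<beta>) at_top\<close> tail] \<open>\<beta> > \<alpha>\<close> \<open>\<alpha> > 0\<close>
    by simp
  have "((\<lambda>x. x powr \<alpha> - scaled_williamson \<alpha> F x) \<longlongrightarrow> m) at_top"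
    unfolding F m by (rule truncated_moment_limit[OF _ \<open>\<alpha> > 0\<close> X_pos int]) measurable
  then show ?thesis
    using tail_diff kendall_renewal_increment_limit[OF df \<open>\<alpha> > 0\<close> cont F_zero[OF order_refl] \<open>y > 0\<close> \<open>m > 0\<close>
        _ tail tail_diff] by blast
qed

end
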